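(* Let $n\ge 3$ and let $A=(a_{ij})\in\mathbb{C}^{n\times n}$ be irreducible with $A\in DE_n$. Then $\rho(H_{BGS})<1$ (i.e., the sequence $\{x^{(i)}\}$ generated by the BGS scheme converges to the unique solution of $Ax=b$ for any choice of the initial guess $x^{(0)}$) if and only if $D_A^{-1}A\notin \mathscr{L}^{\phi}_n$ for every $\phi\in\mathbb{R}$.
   Context: $DE_n$ is the set of $n\times n$ complex matrices that are diagonally equipotent by row: $|a_{ii}|=\sum_{j\ne i}|a_{ij}|$ for all $i$. For $A$ with all $a_{ii}\neq 0$ (automatic for irreducible $A\in DE_n$, $n\ge 2$), write $A=D_A-L_A-U_A$ with $D_A=\mathrm{diag}(a_{11},\dots,a_{nn})$, $L_A$ strictly lower triangular, $U_A$ strictly upper triangular. The backward Gauss-Seidel (BGS) iteration matrix is $H_{BGS}=(D_A-U_A)^{-1}L_A$, and the BGS scheme for $Ax=b$ is $x^{(i+1)}=H_{BGS}x^{(i)}+(D_A-U_A)^{-1}b$, $i=0,1,2,\dots$. $\rho$ denotes the spectral radius. A matrix $(e^{i\phi_{rs}})\in\mathbb{C}^{n\times n}$ ($\phi_{rs}\in\mathbb{R}$, $i=\sqrt{-1}$) is a $\phi$-ray pattern matrix ($\phi\in\mathbb{R}$) if, modulo $2\pi$: (1) $\phi_{rs}+\phi_{sr}\equiv\phi$ for all $r\ne s$; (2) $\phi_{rs}-\phi_{rt}\equiv\phi_{ts}-\phi+\pi$ whenever $r<s<t$ or $s<t<r$ or $t<r<s$; (3) $\phi_{rs}-\phi_{rt}\equiv\phi_{ts}+\pi$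 whenever $r<t<s$ or $t<s<r$ or $s<r<t$; (4) $\phi_{rr}=0$ for all $r$. $\mathscr{L}^{\phi}_n$ is the set of $n\times n$ complex matrices $B=(b_{rs})$ for which there exist $\eta\in\mathbb{R}$ and a $\phi$-ray pattern matrix $(e^{i\phi_{rs}})$ with $b_{rs}=e^{i\eta}|b_{rs}|e^{i\phi_{rs}}$ for all $r,s$. *)

theory Defs
  imports
    "Jordan_Normal_Form.Spectral_Radius"
    "Jordan_Normal_Form.Gauss_Jordan_Elimination"
    "HOL-Combinatorics.Permutations"
    "HOL-Library.Real_Mod"
begin

text \<open>
  Throughout, indices run over \<open>{0..<n}\<close> instead of \<open>{1..n}\<close>; only their order matters.
\<close>

text \<open>
  A square matrix is reducible if some simultaneous permutation of rows and columns brings it to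
  block upper triangular form, with square diagonal blocks of sizes \<open>k\<close> and \<open>n - k\<close>, \<open>0 < k < n\<close>.
\<close>
definition reducible_mat :: "'a :: zero mat \<Rightarrow> bool" where
  "reducible_mat A \<longleftrightarrow> (\<exists>p k. p permutes {..<dim_row A} \<and> 0 < k \<and> k < dim_row A \<and>
     (\<forall>i j. k \<le> i \<and> i < dim_row A \<and> j < k \<longrightarrow> A $$ (p i, p j) = 0))"

definition irreducible_mat :: "'a :: zero mat \<Rightarrow> bool" where
  "irreducible_mat A \<longleftrightarrow> square_mat A \<and> \<not> reducible_mat A"

definition diag_equipotent :: "nat \<Rightarrow> complex mat set" where
  "diag_equipotent n = {A \<in> carrier_mat n n.
     \<forall>i<n. cmod (A $$ (i, i)) = (\<Sum>j \<in> {..<n} - {i}. cmod (A $$ (i, j)))}"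

text \<open>The splitting \<open>A = D - L - U\<close>; note the signs of \<open>L\<close> and \<open>U\<close>.\<close>

definition diag_part :: "complex mat \<Rightarrow> complex mat" where
  "diag_part A = mat (dim_row A) (dim_col A) (\<lambda>(i, j). if i = j then A $$ (i, j) else 0)"

definition lower_part :: "complex mat \<Rightarrow> complex mat" where
  "lower_part A = mat (dim_row A) (dim_col A) (\<lambda>(i, j). if j < i then - A $$ (i, j) else 0)"

definition upper_part :: "complex mat \<Rightarrow> complex mat" where
  "upper_part A = mat (dim_row A) (dim_col A) (\<lambda>(i, j). if i < j then - A $$ (i, j) else 0)"

text \<open>The inverse is unspecified for singular matrices.\<close>
definition inv_mat :: "'a :: field mat \<Rightarrow> 'a mat" where
  "inv_mat A = the (mat_inverse A)"

definition bgs_mat :: "complex mat \<Rightarrow> complex mat" where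
  "bgs_mat A = inv_mat (diag_part A - upper_part A) * lower_part A"

primrec bgs_iter :: "complex mat \<Rightarrow> complex vec \<Rightarrow> complex vec \<Rightarrow> nat \<Rightarrow> complex vec" where
  "bgs_iter A b x0 0 = x0"
| "bgs_iter A b x0 (Suc i) =
     bgs_mat A *\<^sub>v bgs_iter A b x0 i + inv_mat (diag_part A - upper_part A) *\<^sub>v b"

definition bgs_converges :: "complex mat \<Rightarrow> complex vec \<Rightarrow> bool" where
  "bgs_converges A b \<longleftrightarrow>
     (\<exists>x \<in> carrier_vec (dim_col A).
        A *\<^sub>v x = b \<and> (\<forall>y \<in> carrier_vec (dim_col A). A *\<^sub>v y = b \<longrightarrow> y = x) \<and>
        (\<forall>x0 \<in> carrier_vec (dim_col A). \<forall>r < dim_col A.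
           (\<lambda>i. bgs_iter A b x0 i $ r) \<longlonglongrightarrow> x $ r))"

definition ray_pattern_mat :: "nat \<Rightarrow> real \<Rightarrow> complex mat \<Rightarrow> bool" where
  "ray_pattern_mat n \<phi> M \<longleftrightarrow> (\<exists>f :: nat \<Rightarrow> nat \<Rightarrow> real.
     M = mat n n (\<lambda>(r, s). cis (f r s)) \<and>
     (\<forall>r<n. \<forall>s<n. r \<noteq> s \<longrightarrow> [f r s + f s r = \<phi>] (rmod (2 * pi))) \<and>
     (\<forall>r<n. \<forall>s<n. \<forall>t<n. r < s \<and> s < t \<or> s < t \<and> t < r \<or> t < r \<and> r < s \<longrightarrow>
        [f r s - f r t = f t s - \<phi> + pi] (rmod (2 * pi))) \<and>
     (\<forall>r<n. \<forall>s<n. \<forall>t<n. r < t \<and> t < s \<or> t < s \<and> s < r \<or> s < r \<and> r < t \<longrightarrow>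
        [f r s - f r t = f t s + pi] (rmod (2 * pi))) \<and>
     (\<forall>r<n. f r r = 0))"

definition ray_class :: "nat \<Rightarrow> real \<Rightarrow> complex mat set" where
  "ray_class n \<phi> = {B \<in> carrier_mat n n. \<exists>\<eta> :: real. \<exists>M. ray_pattern_mat n \<phi> M \<and>
     (\<forall>r<n. \<forall>s<n. B $$ (r, s) = cis \<eta> * complex_of_real (cmod (B $$ (r, s))) * M $$ (r, s))}"

end

theory Submission
  imports Defs
begin

text \<open>
  A vector \<open>v\<close> is an eigenvector of the iteration matrix for \<open>\<lambda>\<close> iff
  \<open>\<lambda> v\<^sub>i = - (\<Sum>j<i. b\<^sub>i\<^sub>j v\<^sub>j) - \<lambda> (\<Sum>j>i. b\<^sub>i\<^sub>j v\<^sub>j)\<close> for every row, where \<open>b\<^sub>i\<^sub>j = a\<^sub>i\<^sub>j / a\<^sub>i\<^sub>i\<close>.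
  If \<open>\<bar>\<lambda>\<bar> \<ge> 1\<close>, a row in which \<open>\<bar>v\<^sub>i\<bar>\<close> is maximal attains equality in the triangle inequality, so all
  its terms are aligned with \<open>\<lambda> v\<^sub>i\<close>; by irreducibility this spreads to all rows, and the last row
  forces \<open>\<bar>\<lambda>\<bar> = 1\<close>. The alignment of all terms says precisely that the arguments of the entries
  \<open>b\<^sub>i\<^sub>j\<close> form a ray pattern with \<open>\<phi>\<close> the argument of \<open>\<lambda>\<close>, and the computation can be reversed.
\<close>

section \<open>Irreducibility as nonzero entries leaving every proper set of indices\<close>

text \<open>Otherwise, listing the complement of \<open>S\<close> first and \<open>S\<close> last
  would produce a zero block in the lower left corner. This form, strong connectedness of the
  digraph of \<open>A\<close>, lets a property spread from one row to all rows.\<close>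

lemma irreducible_mat_nonzero_exit:
  assumes "irreducible_mat A" "A \<in> carrier_mat n n" "S \<subset> {..<n}" "S \<noteq> {}"
  obtains s t where "s \<in> S" "t < n" "t \<notin> S" "A $$ (s, t) \<noteq> 0"
proof -
  have "\<exists>s\<in>S. \<exists>t<n. t \<notin> S \<and> A $$ (s, t) \<noteq> 0"
  proof (rule ccontr)
    assume "\<not> ?thesis"
    then have zero: "A $$ (s, t) = 0" if "s \<in> S" "t < n" "t \<notin> S" for s t
      using that by blast
    define k where "k = n - card S"
    have fS: "finite S" using assms(3) finite_subset by blast
    have card: "card S < n" "card S > 0"
      using psubset_card_mono[OF _ assms(3)] assms(4) fS by (auto simp: card_gt_0_iff)
    then have k: "0 < k" "k < n" "n - k = card S"
      by (auto simp: k_def)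
    have "card ({..<n} - S) = k"
      using assms(3) fS by (subst card_Diff_subset) (auto simp: k_def)
    then obtain h where h: "bij_betw h {..<k} ({..<n} - S)"
      using finite_same_card_bij[of "{..<k}" "{..<n} - S"] by auto
    obtain g where g: "bij_betw g {k..<n} S"
      using finite_same_card_bij[of "{k..<n}" S] fS k by auto
    \<comment> \<open>The zero block of \<open>reducible_mat\<close> has rows from \<open>k\<close>
      on and columns below \<open>k\<close>, so \<open>S\<close> has to fill the last positions and
      \<open>k\<close> counts its complement.\<close>
    define p where "p = (\<lambda>x. if x < k then h x else if x < n then g x else x)"
    have p1: "bij_betw p {..<k} ({..<n} - S)"
      using h by (rule bij_betw_cong[THEN iffD1, rotated]) (auto simp: p_def)
    have p2: "bij_betw p {k..<n} S"
      using g by (rule bij_betw_cong[THEN iffD1, rotated]) (auto simp: p_def)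
    have "bij_betw p ({..<k} \<union> {k..<n}) (({..<n} - S) \<union> S)"
      using p1 p2 by (rule bij_betw_combine) auto
    moreover have "{..<k} \<union> {k..<n} = {..<n}" "({..<n} - S) \<union> S = {..<n}"
      using k assms(3) by auto
    ultimately have "bij_betw p {..<n} {..<n}" by simp
    then have perm: "p permutes {..<n}"
      using k by (intro bij_imp_permutes) (auto simp: p_def)
    have "A $$ (p i, p j) = 0" if "k \<le> i" "i < n" "j < k" for i j
    proof (rule zero)
      show "p i \<in> S" using bij_betwE[OF p2] that by auto
      show "p j < n" "p j \<notin> S" using bij_betwE[OF p1] that by auto
    qed
    then have "reducible_mat A"
      unfolding reducible_mat_def using perm k assms(2) by (intro exI[of _ p] exI[of _ k]) auto
    then show False using assms(1) by (simp add: irreducible_mat_def)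
  qed
  then show ?thesis using that by blast
qed

text \<open>A zero diagonal entry would force its whole row to vanish, leaving no exit from
  \<open>{i}\<close>, a proper subset because \<open>2 \<le> n\<close>.\<close>

lemma diag_equipotent_diag_nonzero:
  assumes "irreducible_mat A" "A \<in> diag_equipotent n" "2 \<le> n" "i < n"
  shows "A $$ (i, i) \<noteq> 0"
proof
  assume zero: "A $$ (i, i) = 0"
  have A: "A \<in> carrier_mat n n" using assms(2) by (simp add: diag_equipotent_def)
  have "{i} \<noteq> {..<n}"
    using assms(3) by (metis card_lessThan is_singletonI is_singleton_altdef not_less_eq_eq numeral_2_eq_2 One_nat_def order_refl)
  then have "{i} \<subset> {..<n}" using assms(4) by auto
  then obtain s t where st: "s \<in> {i}" "t < n" "t \<notin> {i}" "A $$ (s, t) \<noteq> 0"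
    by (rule irreducible_mat_nonzero_exit[OF assms(1) A]) auto
  have "cmod (A $$ (i, i)) = (\<Sum>j \<in> {..<n} - {i}. cmod (A $$ (i, j)))"
    using assms(2,4) by (simp add: diag_equipotent_def)
  then have "(\<Sum>j \<in> {..<n} - {i}. cmod (A $$ (i, j))) = 0"
    using zero by simp
  then have "cmod (A $$ (i, t)) = 0"
    using st by (subst (asm) sum_nonneg_eq_0_iff) auto
  then show False using st by simp
qed

section \<open>The equality case of the triangle inequality\<close>

text \<open>Projecting onto the direction of the sum bounds each projected summand by its
  \<open>c j\<close>; since these bounds add up to the modulus of the sum, each is attained. The
  conclusion is written without division, so that it also holds for a zero sum.\<close>

lemma complex_norm_sum_eq_aligned:
  fixes w :: "'i \<Rightarrow> complex"
  assumes "finite S" "\<And>j. j \<in> S \<Longrightarrow> norm (w j) \<le> c j" "norm (sum w S) = sum c S" "j \<in> S"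
  shows "norm (sum w S) * w j = c j * sum w S"
proof (cases "sum w S = 0")
  case False
  define z where "z = sum w S"
  have z: "norm z > 0" "z * cnj z = complex_of_real (norm z) ^ 2"
    using False complex_norm_square[of z] by (simp add: z_def, simp)
  have le: "Re (w k * cnj z) \<le> c k * norm z" if "k \<in> S" for k
    using complex_Re_le_cmod[of "w k * cnj z"] mult_right_mono[OF assms(2)[OF that] norm_ge_zero[of z]]
    by (simp add: norm_mult)
  have "(\<Sum>k\<in>S. Re (w k * cnj z)) = Re (z * cnj z)"
    by (simp only: z_def sum_distrib_right Re_sum)
  also have "\<dots> = norm z * norm z"
    by (simp add: z(2) power2_eq_square)
  also have "\<dots> = (\<Sum>k\<in>S. c k * norm z)"
    using assms(3) by (simp add: z_def sum_distrib_right)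
  finally have "Re (w j * cnj z) = c j * norm z"
    using sum_mono_inv[of "\<lambda>k. Re (w k * cnj z)" S "\<lambda>k. c k * norm z" j] le assms(1,4) by auto
  moreover have "norm (w j * cnj z) \<le> c j * norm z"
    using mult_right_mono[OF assms(2)[OF assms(4)] norm_ge_zero[of z]] by (simp add: norm_mult)
  \<comment> \<open>The real part reaches the bound on the modulus, so the imaginary part
    vanishes.\<close>
  ultimately have "w j * cnj z = complex_of_real (c j * norm z)"
    using complex_Re_le_cmod[of "w j * cnj z"] cmod_power2[of "w j * cnj z"]
    by (simp add: complex_eq_iff)
  note w = this
  have "complex_of_real (norm z) * (norm z * w j) = (z * cnj z) * w j"
    by (simp only: z(2) power2_eq_square mult_ac)
  also have "\<dots> = (w j * cnj z) * z" by (simp only: mult_ac)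
  also have "\<dots> = complex_of_real (norm z) * (c j * z)"
    by (simp only: w of_real_mult) (simp only: mult_ac)
  finally have "complex_of_real (norm z) * (norm z * w j) = complex_of_real (norm z) * (c j * z)" .
  then show ?thesis using z(1) by (simp add: z_def)
qed (simp)

section \<open>Inverses of triangular matrices and scaling by the diagonal\<close>

lemma inv_mat_inverse:
  fixes T :: "'a :: field mat"
  assumes "T \<in> carrier_mat n n" "det T \<noteq> 0"
  shows "inv_mat T \<in> carrier_mat n n" "T * inv_mat T = 1\<^sub>m n" "inv_mat T * T = 1\<^sub>m n"
proof -
  have "T \<in> Units (ring_mat TYPE('a) n ())"
    by (rule det_non_zero_imp_unit[OF assms])
  then obtain B where "mat_inverse T = Some B"
    using mat_inverse(1)[OF assms(1), where b = "()"] by (cases "mat_inverse T") auto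
  then show "inv_mat T \<in> carrier_mat n n" "T * inv_mat T = 1\<^sub>m n" "inv_mat T * T = 1\<^sub>m n"
    using mat_inverse(2)[OF assms(1)] by (auto simp: inv_mat_def)
qed

lemma det_upper_triangular_nonzero:
  fixes T :: "'a :: field mat"
  assumes "T \<in> carrier_mat n n" "upper_triangular T" "\<And>i. i < n \<Longrightarrow> T $$ (i, i) \<noteq> 0"
  shows "det T \<noteq> 0"
  using assms by (auto simp: det_upper_triangular[OF assms(2,1)] prod_list_zero_iff diag_mat_def)

text \<open>Identifies the scaled matrix of the theorem with the quotients in the eigenvector
  equations. In \<open>?D * (inv_mat ?D * A) = A\<close> each entry on the left has a single
  summand, since \<open>?D\<close> is diagonal.\<close>

lemma inv_diag_part_mult_index:
  assumes "A \<in> carrier_mat n n" "\<forall>i<n. A $$ (i, i) \<noteq> 0" "i < n" "j < n"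
  shows "(inv_mat (diag_part A) * A) $$ (i, j) = A $$ (i, j) / A $$ (i, i)"
proof -
  let ?D = "diag_part A"
  have D: "?D \<in> carrier_mat n n" using assms(1) by (simp add: diag_part_def)
  have "det ?D \<noteq> 0"
    by (rule det_upper_triangular_nonzero[OF D])
      (use assms(1,2) in \<open>auto simp: diag_part_def upper_triangular_def\<close>)
  note inv = inv_mat_inverse[OF D this]
  have "?D * (inv_mat ?D * A) = A"
    using inv D assms(1) by (simp flip: assoc_mult_mat[of _ n n _ n _ n])
  then have "A $$ (i, j) = (?D * (inv_mat ?D * A)) $$ (i, j)" by simp
  also have "\<dots> = (\<Sum>k<n. ?D $$ (i, k) * (inv_mat ?D * A) $$ (k, j))"
    using inv(1) D assms by (subst index_mult_mat) (auto simp: scalar_prod_def atLeast0LessThan)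
  also have "\<dots> = (\<Sum>k<n. if k = i then A $$ (i, i) * (inv_mat ?D * A) $$ (i, j) else 0)"
    using assms by (intro sum.cong) (auto simp: diag_part_def)
  finally show ?thesis using assms by (simp add: field_simps)
qed

section \<open>The backward Gauss-Seidel matrix, its fixed points and eigenvectors\<close>

context
  fixes n :: nat and A :: "complex mat"
  assumes A: "A \<in> carrier_mat n n"
    and diag_nz: "\<forall>i<n. A $$ (i, i) \<noteq> 0"
begin

lemma lower_part_carrier: "lower_part A \<in> carrier_mat n n"
  using A by (simp add: lower_part_def)

lemma diag_minus_upper_carrier: "diag_part A - upper_part A \<in> carrier_mat n n"
  using A by (intro minus_carrier_mat) (simp add: upper_part_def)

lemma diag_minus_upper_inverse:
  "inv_mat (diag_part A - upper_part A) \<in> carrier_mat n n"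
  "(diag_part A - upper_part A) * inv_mat (diag_part A - upper_part A) = 1\<^sub>m n"
  "inv_mat (diag_part A - upper_part A) * (diag_part A - upper_part A) = 1\<^sub>m n"
proof -
  have "det (diag_part A - upper_part A) \<noteq> 0"
    by (rule det_upper_triangular_nonzero[OF diag_minus_upper_carrier])
      (use A diag_nz in \<open>auto simp: diag_part_def upper_part_def upper_triangular_def\<close>)
  from inv_mat_inverse[OF diag_minus_upper_carrier this]
  show "inv_mat (diag_part A - upper_part A) \<in> carrier_mat n n"
    "(diag_part A - upper_part A) * inv_mat (diag_part A - upper_part A) = 1\<^sub>m n"
    "inv_mat (diag_part A - upper_part A) * (diag_part A - upper_part A) = 1\<^sub>m n" .
qed

lemma bgs_mat_carrier: "bgs_mat A \<in> carrier_mat n n"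
  using diag_minus_upper_inverse(1) lower_part_carrier by (simp add: bgs_mat_def)

lemma splitting: "A = (diag_part A - upper_part A) - lower_part A"
  using A by (intro eq_matI) (auto simp: diag_part_def upper_part_def lower_part_def)

text \<open>Multiplying by the invertible triangular factor removes the inverse. The case
  \<open>y = x\<close> describes fixed points; a zero \<open>b\<close> with \<open>y\<close> a
  multiple of \<open>x\<close> describes eigenvectors.\<close>

lemma bgs_mat_solve_iff:
  assumes "x \<in> carrier_vec n" "y \<in> carrier_vec n" "b \<in> carrier_vec n"
  shows "y = bgs_mat A *\<^sub>v x + inv_mat (diag_part A - upper_part A) *\<^sub>v b \<longleftrightarrow>
    (diag_part A - upper_part A) *\<^sub>v y = lower_part A *\<^sub>v x + b"
proof -
  define T L J where "T = diag_part A - upper_part A" and "L = lower_part A"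
    and "J = inv_mat (diag_part A - upper_part A)"
  have T: "T \<in> carrier_mat n n" and L: "L \<in> carrier_mat n n" and J: "J \<in> carrier_mat n n"
    and TJ: "T * J = 1\<^sub>m n" and JT: "J * T = 1\<^sub>m n"
    using diag_minus_upper_carrier lower_part_carrier diag_minus_upper_inverse
    by (simp_all add: T_def L_def J_def)
  have Lx: "L *\<^sub>v x \<in> carrier_vec n" using L assms by simp
  have eq: "bgs_mat A *\<^sub>v x + J *\<^sub>v b = J *\<^sub>v (L *\<^sub>v x + b)"
    using J L assms Lx
    by (simp add: bgs_mat_def J_def[symmetric] L_def[symmetric] assoc_mult_mat_vec[OF J L]
        mult_add_distrib_mat_vec[OF J])
  have "y = J *\<^sub>v (L *\<^sub>v x + b) \<longleftrightarrow> T *\<^sub>v y = L *\<^sub>v x + b"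
  proof
    assume "y = J *\<^sub>v (L *\<^sub>v x + b)"
    then show "T *\<^sub>v y = L *\<^sub>v x + b"
      using assoc_mult_mat_vec[OF T J, of "L *\<^sub>v x + b"] TJ Lx assms by simp
  next
    assume "T *\<^sub>v y = L *\<^sub>v x + b"
    then show "y = J *\<^sub>v (L *\<^sub>v x + b)"
      using assoc_mult_mat_vec[OF J T, of y] JT assms by simp
  qed
  then show ?thesis using eq by (simp add: T_def L_def J_def)
qed

lemma bgs_mat_fixpoint_iff:
  assumes "x \<in> carrier_vec n" "b \<in> carrier_vec n"
  shows "A *\<^sub>v x = b \<longleftrightarrow> x = bgs_mat A *\<^sub>v x + inv_mat (diag_part A - upper_part A) *\<^sub>v b"
proof -
  have "A *\<^sub>v x = (diag_part A - upper_part A) *\<^sub>v x - lower_part A *\<^sub>v x"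
    by (subst splitting)
      (rule minus_mult_distrib_mat_vec[OF diag_minus_upper_carrier lower_part_carrier assms(1)])
  moreover have "(diag_part A - upper_part A) *\<^sub>v x \<in> carrier_vec n"
    "lower_part A *\<^sub>v x \<in> carrier_vec n"
    using diag_minus_upper_carrier lower_part_carrier assms by auto
  moreover have "p - q = b \<longleftrightarrow> p = q + b"
    if "p \<in> carrier_vec n" "q \<in> carrier_vec n" for p q :: "complex vec"
    using that assms(2) by (auto simp: vec_eq_iff algebra_simps)
  ultimately show ?thesis
    unfolding bgs_mat_solve_iff[OF assms(1) assms] by metis
qed

text \<open>This is row \<open>i\<close> of \<open>(D - U)(k v) = L v\<close>, divided by the
  diagonal entry. The weight is \<open>1\<close> below the diagonal, where \<open>L\<close> meets
  \<open>v\<close>, and \<open>k\<close> above it, where \<open>U\<close> meets \<open>k v\<close>.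
  Nothing is divided by \<open>k\<close>, so \<open>k = 0\<close> is covered.\<close>

lemma bgs_mat_eigen_iff:
  assumes v: "v \<in> carrier_vec n"
  shows "bgs_mat A *\<^sub>v v = k \<cdot>\<^sub>v v \<longleftrightarrow>
    (\<forall>i<n. k * v $ i =
       (\<Sum>j \<in> {..<n} - {i}. - (if j < i then 1 else k) * (A $$ (i, j) / A $$ (i, i)) * v $ j))"
    (is "_ \<longleftrightarrow> ?R")
proof -
  have kv: "k \<cdot>\<^sub>v v \<in> carrier_vec n" using v by simp
  have row: "((diag_part A - upper_part A) *\<^sub>v (k \<cdot>\<^sub>v v)) $ i = (lower_part A *\<^sub>v v) $ i \<longleftrightarrow>
    k * v $ i =
       (\<Sum>j \<in> {..<n} - {i}. - (if j < i then 1 else k) * (A $$ (i, j) / A $$ (i, i)) * v $ j)"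
    if i: "i < n" for i
  proof -
    have a: "((diag_part A - upper_part A) *\<^sub>v (k \<cdot>\<^sub>v v)) $ i =
       (\<Sum>j<n. (if j < i then 0 else A $$ (i, j)) * (k * v $ j))"
      using A v i by (auto simp: scalar_prod_def diag_part_def upper_part_def atLeast0LessThan
          intro!: sum.cong)
    have b: "(lower_part A *\<^sub>v v) $ i = (\<Sum>j<n. (if j < i then - A $$ (i, j) else 0) * v $ j)"
      using A v i by (auto simp: scalar_prod_def lower_part_def atLeast0LessThan intro!: sum.cong)
    have "((diag_part A - upper_part A) *\<^sub>v (k \<cdot>\<^sub>v v)) $ i - (lower_part A *\<^sub>v v) $ i =
       (\<Sum>j<n. (if j < i then 1 else k) * A $$ (i, j) * v $ j)"
      unfolding a b sum_subtractf[symmetric] by (intro sum.cong) auto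
    also have "\<dots> = A $$ (i, i) * (k * v $ i -
       (\<Sum>j \<in> {..<n} - {i}. - (if j < i then 1 else k) * (A $$ (i, j) / A $$ (i, i)) * v $ j))"
    proof -
      have "(\<Sum>j \<in> {..<n} - {i}. (if j < i then 1 else k) * A $$ (i, j) * v $ j) =
        - (A $$ (i, i) * (\<Sum>j \<in> {..<n} - {i}.
             - (if j < i then 1 else k) * (A $$ (i, j) / A $$ (i, i)) * v $ j))"
        unfolding sum_distrib_left sum_negf[symmetric]
        using diag_nz[rule_format, OF i] by (intro sum.cong) auto
      moreover have "(\<Sum>j<n. (if j < i then 1 else k) * A $$ (i, j) * v $ j) =
        k * A $$ (i, i) * v $ i +
        (\<Sum>j \<in> {..<n} - {i}. (if j < i then 1 else k) * A $$ (i, j) * v $ j)"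
        using i by (subst sum.remove[of _ i]) simp_all
      moreover have "k * a * x + - (a * s) = a * (k * x - s)" for a x s :: complex
        by (simp add: algebra_simps)
      ultimately show ?thesis by (simp only:)
    qed
    finally show ?thesis
      by (subst (1 2) eq_iff_diff_eq_0) (simp only: mult_eq_0_iff diag_nz[rule_format, OF i] simp_thms)
  qed
  have "bgs_mat A *\<^sub>v v + inv_mat (diag_part A - upper_part A) *\<^sub>v 0\<^sub>v n = bgs_mat A *\<^sub>v v"
    using bgs_mat_carrier diag_minus_upper_inverse(1) v by (intro eq_vecI) auto
  then have "bgs_mat A *\<^sub>v v = k \<cdot>\<^sub>v v \<longleftrightarrow>
    (diag_part A - upper_part A) *\<^sub>v (k \<cdot>\<^sub>v v) = lower_part A *\<^sub>v v"
    using bgs_mat_solve_iff[OF v kv, of "0\<^sub>v n"] lower_part_carrier v by auto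
  also have "\<dots> \<longleftrightarrow> (\<forall>i<n. ((diag_part A - upper_part A) *\<^sub>v (k \<cdot>\<^sub>v v)) $ i = (lower_part A *\<^sub>v v) $ i)"
    using carrier_matD[OF diag_minus_upper_carrier] carrier_matD[OF lower_part_carrier]
    by (simp only: vec_eq_iff dim_mult_mat_vec refl simp_thms)
  also have "\<dots> \<longleftrightarrow> ?R" using row by blast
  finally show ?thesis .
qed

text \<open>In every row the \<open>norm (b i j)\<close> add up to 1 and the remaining factors have
  modulus at most \<open>norm k * m\<close>, so a row of maximal modulus leaves no slack. Constant
  modulus and alignment are the data from which the ray pattern is built.\<close>

lemma bgs_mat_peripheral_eigenvector:
  assumes irr: "irreducible_mat A" and eq: "A \<in> diag_equipotent n" and n: "2 \<le> n"
    and v: "v \<in> carrier_vec n" "v \<noteq> 0\<^sub>v n" and ev: "bgs_mat A *\<^sub>v v = k \<cdot>\<^sub>v v"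
    and k: "1 \<le> norm k"
  shows "norm k = 1"
    "\<exists>m>0. (\<forall>i<n. norm (v $ i) = m) \<and>
      (\<forall>i<n. \<forall>j<n. i \<noteq> j \<longrightarrow> - (if j < i then 1 else k) * (A $$ (i, j) / A $$ (i, i)) * v $ j =
         norm (A $$ (i, j) / A $$ (i, i)) * (k * v $ i))"
proof -
  define b where "b = (\<lambda>i j. A $$ (i, j) / A $$ (i, i))"
  define g where "g = (\<lambda>i j::nat. if j < i then 1 else k)"
  \<comment> \<open>By \<open>1 \<le> norm k\<close>, the weight \<open>1\<close> of the lower
    entries is no larger in modulus than that of the upper ones.\<close>
  have g_le: "norm (g i j) \<le> norm k" for i j using k by (simp add: g_def)
  have b_sum: "(\<Sum>j \<in> {..<n} - {i}. norm (b i j)) = 1" if "i < n" for i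
  proof -
    have "(\<Sum>j \<in> {..<n} - {i}. norm (b i j)) =
        (\<Sum>j \<in> {..<n} - {i}. norm (A $$ (i, j))) / norm (A $$ (i, i))"
      by (simp add: b_def norm_divide sum_divide_distrib)
    also have "(\<Sum>j \<in> {..<n} - {i}. norm (A $$ (i, j))) = norm (A $$ (i, i))"
      using eq that by (simp add: diag_equipotent_def)
    finally show ?thesis using diag_nz[rule_format, OF that] by simp
  qed
  have rows: "k * v $ i = (\<Sum>j \<in> {..<n} - {i}. - g i j * b i j * v $ j)" if "i < n" for i
    using bgs_mat_eigen_iff[OF v(1), of k] ev that by (simp add: b_def g_def)
  define m where "m = Max ((\<lambda>i. norm (v $ i)) ` {..<n})"
  have le_m: "norm (v $ i) \<le> m" if "i < n" for i
    using that by (auto simp: m_def)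
  have "\<exists>i<n. v $ i \<noteq> 0" using v by (auto simp: vec_eq_iff)
  then have m: "m > 0"
    using le_m by (meson less_le_trans zero_less_norm_iff)
  have aligned: "- g i j * b i j * v $ j = norm (b i j) * (k * v $ i)"
    if i: "i < n" "norm (v $ i) = m" and j: "j < n" "j \<noteq> i" for i j
  proof -
    let ?w = "\<lambda>j. - g i j * b i j * v $ j" and ?c = "\<lambda>j. norm k * norm (b i j) * m"
    let ?S = "{..<n} - {i}"
    have "norm (?w j) \<le> ?c j" if "j \<in> ?S" for j
      using that le_m[of j] g_le[of i j] m by (auto simp: norm_mult intro!: mult_mono)
    \<comment> \<open>The left side is \<open>norm (k * v $ i)\<close> by the row equation; the
      right side is \<open>norm k * m\<close> because the moduli in row \<open>i\<close> of
      \<open>b\<close> have sum 1.\<close>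
    moreover have "norm (sum ?w ?S) = sum ?c ?S"
      unfolding rows[OF i(1), symmetric]
      using i b_sum[OF i(1)] by (simp add: norm_mult flip: sum_distrib_left sum_distrib_right)
    moreover have "j \<in> ?S" using j by simp
    ultimately have "norm (sum ?w ?S) * ?w j = ?c j * sum ?w ?S"
      by (intro complex_norm_sum_eq_aligned) auto
    then have "complex_of_real (norm k * m) * ?w j =
        complex_of_real (norm k * m) * (norm (b i j) * (k * v $ i))"
      unfolding rows[OF i(1), symmetric] using i(2) by (simp add: norm_mult mult_ac)
    moreover have "complex_of_real (norm k * m) \<noteq> 0"
      using m k by (auto simp flip: of_real_mult)
    ultimately show ?thesis by (meson mult_left_cancel)
  qed
  have modulus: "norm (g i j) * norm (v $ j) = norm k * m"
    if "i < n" "norm (v $ i) = m" "j < n" "j \<noteq> i" "b i j \<noteq> 0" for i j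
    using arg_cong[OF aligned[OF that(1-4)], of norm] that by (simp add: norm_mult)
  \<comment> \<open>The rows of maximal modulus: \<open>modulus\<close> carries membership across
    every nonzero entry, so by irreducibility \<open>S\<close> cannot be a proper subset.\<close>
  define S where "S = {i. i < n \<and> norm (v $ i) = m}"
  have "S = {..<n}"
  proof (rule ccontr)
    assume "S \<noteq> {..<n}"
    then have "S \<subset> {..<n}" by (auto simp: S_def)
    moreover have "m \<in> (\<lambda>i. norm (v $ i)) ` {..<n}"
      unfolding m_def using n by (intro Max_in) (auto simp: lessThan_empty_iff)
    then have "S \<noteq> {}" by (auto simp: S_def)
    ultimately obtain s t where st: "s \<in> S" "t < n" "t \<notin> S" "A $$ (s, t) \<noteq> 0"
      by (rule irreducible_mat_nonzero_exit[OF irr A])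
    then have s: "s < n" "norm (v $ s) = m" "t \<noteq> s" by (auto simp: S_def)
    then have "b s t \<noteq> 0" using st diag_nz by (simp add: b_def)
    then have "norm (g s t) * norm (v $ t) = norm k * m"
      using modulus[OF s(1,2) st(2) s(3)] by simp
    moreover have "norm (g s t) * norm (v $ t) \<le> norm k * norm (v $ t)"
      using g_le by (intro mult_right_mono) auto
    ultimately have "norm k * m \<le> norm k * norm (v $ t)" by simp
    moreover have "0 < norm k" using k by linarith
    ultimately have "m \<le> norm (v $ t)" by simp
    then show False using st le_m[OF st(2)] by (simp add: S_def)
  qed
  then have all_m: "norm (v $ i) = m" if "i < n" for i
    using that by (auto simp: S_def)
  \<comment> \<open>In the last row every off-diagonal weight is \<open>1\<close>; a nonzero entry
    there gives \<open>m = norm k * m\<close>.\<close>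
  have "(\<Sum>j \<in> {..<n} - {n - 1}. norm (b (n - 1) j)) \<noteq> 0"
    using b_sum[of "n - 1"] n by simp
  then obtain j where "j \<in> {..<n} - {n - 1}" "norm (b (n - 1) j) \<noteq> 0"
    by (rule sum.not_neutral_contains_not_neutral)
  then have j: "j < n" "j \<noteq> n - 1" "b (n - 1) j \<noteq> 0" by auto
  then have "norm (g (n - 1) j) * m = norm k * m"
    using modulus[of "n - 1" j] all_m n by simp
  moreover have "g (n - 1) j = 1" using j by (simp add: g_def)
  ultimately show "norm k = 1" using m by simp
  show "\<exists>m>0. (\<forall>i<n. norm (v $ i) = m) \<and>
      (\<forall>i<n. \<forall>j<n. i \<noteq> j \<longrightarrow> - (if j < i then 1 else k) * (A $$ (i, j) / A $$ (i, i)) * v $ j =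
         norm (A $$ (i, j) / A $$ (i, i)) * (k * v $ i))"
    using m all_m aligned by (intro exI[of _ m]) (auto simp: b_def g_def)
qed

end

section \<open>Ray patterns as unimodular diagonal scalings\<close>

text \<open>The pattern conditions are cocycle relations, solved modulo \<open>2 * pi\<close> by
  \<open>\<theta> i - \<theta> j + pi\<close>, plus \<open>\<phi>\<close> below the diagonal. With
  \<open>u i = cis (\<theta> i)\<close>, membership means that conjugating \<open>B\<close> by the
  diagonal matrix of \<open>u\<close> gives entries \<open>- |b|\<close> above and
  \<open>- cis \<phi> * |b|\<close> below the diagonal.\<close>

lemma ray_class_iff_unimodular:
  assumes B: "B \<in> carrier_mat n n" and n: "0 < n" and diag: "\<forall>i<n. B $$ (i, i) = 1"
  shows "B \<in> ray_class n \<phi> \<longleftrightarrow> (\<exists>u :: nat \<Rightarrow> complex. (\<forall>i<n. norm (u i) = 1) \<and>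
    (\<forall>i<n. \<forall>j<n. i \<noteq> j \<longrightarrow>
       B $$ (i, j) * u j = - norm (B $$ (i, j)) * (if j < i then cis \<phi> else 1) * u i))"
    (is "_ \<longleftrightarrow> ?R")
proof
  assume "B \<in> ray_class n \<phi>"
  then obtain \<eta> f where
    B_eq: "\<And>r s. r < n \<Longrightarrow> s < n \<Longrightarrow> B $$ (r, s) = cis \<eta> * norm (B $$ (r, s)) * cis (f r s)"
    and c1: "\<And>r s. r < n \<Longrightarrow> s < n \<Longrightarrow> r \<noteq> s \<Longrightarrow> cis (f r s + f s r) = cis \<phi>"
    and c2: "\<And>r s t. r < n \<Longrightarrow> s < n \<Longrightarrow> t < n \<Longrightarrow> r < s \<and> s < t \<or> s < t \<and> t < r \<or> t < r \<and> r < s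
      \<Longrightarrow> cis (f r s - f r t) = cis (f t s - \<phi> + pi)"
    and c3: "\<And>r s t. r < n \<Longrightarrow> s < n \<Longrightarrow> t < n \<Longrightarrow> r < t \<and> t < s \<or> t < s \<and> s < r \<or> s < r \<and> r < t
      \<Longrightarrow> cis (f r s - f r t) = cis (f t s + pi)"
    and f0: "\<And>r. r < n \<Longrightarrow> f r r = 0"
    unfolding ray_class_def ray_pattern_mat_def cis_eq_iff by fastforce
  \<comment> \<open>The entry \<open>(0, 0)\<close> is \<open>1\<close> both in \<open>B\<close> and
    in the pattern, which removes the common factor.\<close>
  have "cis \<eta> = 1" using B_eq[of 0 0] diag f0[OF n] n by simp
  then have B_eq: "B $$ (i, j) = norm (B $$ (i, j)) * cis (f i j)" if "i < n" "j < n" for i j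
    using B_eq[OF that] by simp
  \<comment> \<open>Read off from row 0, where alignment demands
    \<open>cis (f 0 j) * u j = - 1\<close>. Index 0 is separate, since \<open>f 0 0 = 0\<close>
    would give \<open>- 1\<close> there.\<close>
  define u where "u = (\<lambda>j::nat. if j = 0 then 1 else cis (pi - f 0 j))"
  have key: "cis (f i j) * u j = - (if j < i then cis \<phi> else 1) * u i"
    if ij: "i < n" "j < n" "i \<noteq> j" for i j
  proof -
    \<comment> \<open>Row 0 holds by the choice of \<open>u\<close>, column 0 by the first pattern
      condition; the rest compares columns \<open>i\<close> and \<open>j\<close> in row 0 by the
      condition for the respective cyclic order.\<close>
    consider "i = 0" "0 < j" | "j = 0" "0 < i" | "0 < i" "i < j" | "0 < j" "j < i"
      using ij by linarith
    then show ?thesis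
    proof cases
      case 1
      then show ?thesis by (simp add: u_def cis_mult flip: cis_pi)
    next
      case 2
      then have "cis (f 0 i + f i 0) = cis \<phi>" using c1[of 0 i] ij by simp
      then have "cis (f i 0) * cis (f 0 i) = cis \<phi>" by (simp add: cis_mult add.commute)
      then show ?thesis using 2 by (simp add: u_def field_simps flip: cis_divide)
    next
      case 3
      then have "cis (f 0 j - f 0 i) = cis (f i j + pi)" using c3[of 0 j i] ij n by simp
      then show ?thesis using 3
        by (simp add: u_def field_simps flip: cis_divide cis_mult)
    next
      case 4
      then have "cis (f 0 j - f 0 i) = cis (f i j - \<phi> + pi)" using c2[of 0 j i] ij n by simp
      then show ?thesis using 4
        by (simp add: u_def field_simps flip: cis_divide cis_mult)
    qed
  qed
  have "norm (u i) = 1" for i by (simp add: u_def)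
  moreover have "B $$ (i, j) * u j = - norm (B $$ (i, j)) * (if j < i then cis \<phi> else 1) * u i"
    if "i < n" "j < n" "i \<noteq> j" for i j
    using key[OF that] by (subst B_eq[OF that(1,2)]) (simp add: mult.assoc)
  ultimately show ?R by blast
next
  assume ?R
  then obtain u :: "nat \<Rightarrow> complex" where u: "\<And>i. i < n \<Longrightarrow> norm (u i) = 1"
    and Bu: "\<And>i j. i < n \<Longrightarrow> j < n \<Longrightarrow> i \<noteq> j \<Longrightarrow>
       B $$ (i, j) * u j = - norm (B $$ (i, j)) * (if j < i then cis \<phi> else 1) * u i"
    by blast
  define \<theta> where "\<theta> = (\<lambda>i. Arg (u i))"
  have u_cis: "u i = cis (\<theta> i)" if "i < n" for i
  proof -
    have "u i \<noteq> 0" using u[OF that] by auto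
    then show ?thesis using cis_Arg[of "u i"] u[OF that] by (simp add: \<theta>_def sgn_eq)
  qed
  \<comment> \<open>The alignment equation solved for the argument of the entry, with the diagonal
    set to \<open>0\<close> as the fourth condition demands.\<close>
  define f where
    "f = (\<lambda>i j. if i = j then 0 else \<theta> i - \<theta> j + pi + (if j < i then \<phi> else 0))"
  \<comment> \<open>In each of the three congruences below, the two sides differ by exactly one
    period.\<close>
  have rcongI: "[a = b] (rmod (2 * pi))" if "b = a + 2 * pi \<or> b = a - 2 * pi" for a b
    using that by (auto simp: rcong_altdef intro: exI[of _ 1] exI[of _ "-1"])
  have "ray_pattern_mat n \<phi> (mat n n (\<lambda>(r, s). cis (f r s)))"
    unfolding ray_pattern_mat_def
  proof (intro exI[of _ f] conjI allI impI)
    show "[f r s + f s r = \<phi>] (rmod (2 * pi))" if "r \<noteq> s" for r s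
      using that by (intro rcongI) (auto simp: f_def)
    show "[f r s - f r t = f t s - \<phi> + pi] (rmod (2 * pi))"
      if "r < s \<and> s < t \<or> s < t \<and> t < r \<or> t < r \<and> r < s" for r s t
      using that by (intro rcongI) (auto simp: f_def)
    show "[f r s - f r t = f t s + pi] (rmod (2 * pi))"
      if "r < t \<and> t < s \<or> t < s \<and> s < r \<or> s < r \<and> r < t" for r s t
      using that by (intro rcongI) (auto simp: f_def)
  qed (simp_all add: f_def)
  moreover have "B $$ (r, s) = cis 0 * norm (B $$ (r, s)) * mat n n (\<lambda>(r, s). cis (f r s)) $$ (r, s)"
    if rs: "r < n" "s < n" for r s
  proof (cases "r = s")
    case True
    then show ?thesis using diag rs by (simp add: f_def)
  next
    case False
    have "B $$ (r, s) * cis (\<theta> s) =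
        - norm (B $$ (r, s)) * (if s < r then cis \<phi> else 1) * cis (\<theta> r)"
      using Bu[OF rs False] u_cis rs by simp
    then have "B $$ (r, s) =
        - norm (B $$ (r, s)) * (if s < r then cis \<phi> else 1) * cis (\<theta> r) / cis (\<theta> s)"
      by (simp add: field_simps)
    also have "\<dots> = norm (B $$ (r, s)) * cis (f r s)"
      using False by (simp add: f_def mult_ac flip: cis_divide cis_mult)
    finally show ?thesis using rs by simp
  qed
  ultimately show "B \<in> ray_class n \<phi>"
    unfolding ray_class_def using B by blast
qed

section \<open>Spectral radius and decay of matrix powers\<close>

lemma spectral_radius_less_1_iff:
  assumes "H \<in> carrier_mat n n" "0 < n"
  shows "spectral_radius H < 1 \<longleftrightarrow> \<not> (\<exists>k v. eigenvector H v k \<and> 1 \<le> norm k)"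
  using spectral_radius_mem_max[OF assms]
  by (fastforce simp: spectrum_def eigenvalue_def not_less)

lemma smult_pow_mat:
  fixes H :: "'a :: comm_ring_1 mat"
  assumes "H \<in> carrier_mat n n"
  shows "(c \<cdot>\<^sub>m H) ^\<^sub>m k = c ^ k \<cdot>\<^sub>m (H ^\<^sub>m k)"
proof (induction k)
  case 0
  then show ?case by (intro eq_matI) auto
next
  case (Suc k)
  have "H ^\<^sub>m k \<in> carrier_mat n n" using assms by simp
  then show ?case using assms Suc
    by (intro eq_matI) (auto simp: mult_ac)
qed

text \<open>Dividing by some \<open>r\<close> strictly between the spectral radius and 1 keeps the
  spectral radius below 1, so the powers of the scaled matrix \<open>G\<close> are bounded and those
  of \<open>H\<close> decay like \<open>r ^ k\<close>.\<close>

lemma spectral_radius_less_1_pow_tendsto_0: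
  fixes H :: "complex mat"
  assumes H: "H \<in> carrier_mat n n" and lt: "spectral_radius H < 1" and ij: "i < n" "j < n"
  shows "(\<lambda>k. (H ^\<^sub>m k) $$ (i, j)) \<longlonglongrightarrow> 0"
proof -
  have n: "0 < n" using ij by simp
  \<comment> \<open>The midpoint is positive even when the spectral radius is 0, so division by it
    is safe.\<close>
  define r where "r = (1 + spectral_radius H) / 2"
  have "0 \<le> spectral_radius H"
    using spectral_radius_mem_max(1)[OF H n] by auto
  then have r: "0 < r" "r < 1" "spectral_radius H < r" using lt by (auto simp: r_def)
  define G where "G = complex_of_real (1 / r) \<cdot>\<^sub>m H"
  have G: "G \<in> carrier_mat n n" using H by (simp add: G_def)
  have H_eq: "H = complex_of_real r \<cdot>\<^sub>m G"
    using r H by (intro eq_matI) (auto simp: G_def)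
  have "norm k < 1" if "eigenvector G v k" for v k
  proof -
    have v: "v \<in> carrier_vec n" "v \<noteq> 0\<^sub>v n" "G *\<^sub>v v = k \<cdot>\<^sub>v v"
      using that G by (auto simp: eigenvector_def)
    have "H *\<^sub>v v = complex_of_real r \<cdot>\<^sub>v (G *\<^sub>v v)"
      unfolding H_eq using G v(1)
      by (intro eq_vecI) (auto simp: scalar_prod_def sum_distrib_left mult.assoc)
    then have "eigenvector H v (r * k)"
      using v H by (simp add: eigenvector_def smult_smult_assoc)
    then have "norm (r * k) \<le> spectral_radius H"
      by (intro spectral_radius_mem_max(2)[OF H n, unfolded spectrum_def eigenvalue_def]) blast
    then have "r * norm k \<le> spectral_radius H" using r(1) by (simp add: norm_mult)
    then have "r * norm k < r * 1" using r(3) by linarith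
    then show ?thesis using r(1) mult_less_cancel_left_pos by blast
  qed
  then have "spectral_radius G < 1"
    using spectral_radius_less_1_iff[OF G n] by (meson not_less)
  then obtain c where c: "\<And>k. norm_bound (G ^\<^sub>m k) c"
    using spectral_radius_jnf_norm_bound_less_1_upper_triangular[OF G] by blast
  have bound: "norm ((H ^\<^sub>m k) $$ (i, j)) \<le> r ^ k * c" for k
  proof -
    have "norm ((G ^\<^sub>m k) $$ (i, j)) \<le> c"
      using c[of k] ij G by (auto simp: norm_bound_def pow_mat_dim)
    then show ?thesis
      using r G ij unfolding H_eq smult_pow_mat[OF G]
      by (simp add: norm_mult norm_power mult_left_mono)
  qed
  have "(\<lambda>k. r ^ k) \<longlonglongrightarrow> 0"
    using r(1,2) by (intro LIMSEQ_realpow_zero) simp_all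
  moreover have "norm ((H ^\<^sub>m k) $$ (i, j)) \<le> norm (r ^ k) * c" for k
    using bound[of k] abs_of_pos[OF r(1)] by (simp only: real_norm_def power_abs)
  ultimately show ?thesis by (rule tendsto_0_le[OF _ always_eventually[OF allI]])
qed

section \<open>Convergence of the scheme\<close>

text \<open>The solution \<open>x\<close> is a fixed point of the affine step, so each step
  multiplies the error by \<open>bgs_mat A\<close>.\<close>

lemma bgs_iter_error:
  assumes A: "A \<in> carrier_mat n n" and diag_nz: "\<forall>i<n. A $$ (i, i) \<noteq> 0"
    and x: "x \<in> carrier_vec n" "A *\<^sub>v x = b" and w: "w \<in> carrier_vec n" and b: "b \<in> carrier_vec n"
  shows "bgs_iter A b (x + w) k = x + bgs_mat A ^\<^sub>m k *\<^sub>v w"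
  using w
proof (induction k arbitrary: w)
  case 0
  then show ?case using bgs_mat_carrier[OF A diag_nz] by simp
next
  case (Suc k)
  note H = bgs_mat_carrier[OF A diag_nz]
  \<comment> \<open>\<open>bgs_iter\<close> unfolds at the last step; moving the first step into the
    initial guess lets the induction hypothesis act on the error
    \<open>bgs_mat A *\<^sub>v w\<close>.\<close>
  have shift: "bgs_iter A b y (Suc k) =
      bgs_iter A b (bgs_mat A *\<^sub>v y + inv_mat (diag_part A - upper_part A) *\<^sub>v b) k" for y k
    by (induction k) auto
  have Hw: "bgs_mat A *\<^sub>v w \<in> carrier_vec n" using H Suc.prems by simp
  have "bgs_mat A *\<^sub>v (x + w) + inv_mat (diag_part A - upper_part A) *\<^sub>v b =
      (bgs_mat A *\<^sub>v x + inv_mat (diag_part A - upper_part A) *\<^sub>v b) + bgs_mat A *\<^sub>v w"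
    using H x Suc.prems b diag_minus_upper_inverse(1)[OF A diag_nz]
    by (intro eq_vecI) (auto simp: scalar_prod_add_distrib[of _ n])
  also have "\<dots> = x + bgs_mat A *\<^sub>v w"
    using bgs_mat_fixpoint_iff[OF A diag_nz x(1) b] x(2) by simp
  finally have "bgs_iter A b (x + w) (Suc k) = x + bgs_mat A ^\<^sub>m k *\<^sub>v (bgs_mat A *\<^sub>v w)"
    using Suc.IH[OF Hw] by (simp only: shift)
  also have "\<dots> = x + bgs_mat A ^\<^sub>m Suc k *\<^sub>v w"
    using H Suc.prems by (simp add: assoc_mult_mat_vec[of _ n n _ n])
  finally show ?case .
qed

text \<open>An eigenvector with \<open>1 \<le> norm k\<close>, taken as initial error, never dies
  out. Conversely, the powers of the iteration matrix tend to zero, and the absence of the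
  eigenvalue 1 makes \<open>A\<close> invertible, which supplies the unique solution that
  \<open>bgs_converges\<close> asks for.\<close>

lemma bgs_converges_iff:
  assumes A: "A \<in> carrier_mat n n" and diag_nz: "\<forall>i<n. A $$ (i, i) \<noteq> 0"
    and n: "0 < n" and b: "b \<in> carrier_vec n"
  shows "bgs_converges A b \<longleftrightarrow> spectral_radius (bgs_mat A) < 1"
proof
  note H = bgs_mat_carrier[OF A diag_nz]
  {
    assume "bgs_converges A b"
    then obtain x where x: "x \<in> carrier_vec n" "A *\<^sub>v x = b" and conv:
      "\<And>x0 r. x0 \<in> carrier_vec n \<Longrightarrow> r < n \<Longrightarrow> (\<lambda>i. bgs_iter A b x0 i $ r) \<longlonglongrightarrow> x $ r"
      using A by (auto simp: bgs_converges_def)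
    have False if ev: "eigenvector (bgs_mat A) v k" and k: "1 \<le> norm k" for v k
    proof -
      have v: "v \<in> carrier_vec n" "v \<noteq> 0\<^sub>v n" using ev H by (auto simp: eigenvector_def)
      then obtain r where r: "r < n" "v $ r \<noteq> 0" by (auto simp: vec_eq_iff)
      have "bgs_iter A b (x + v) i $ r = x $ r + k ^ i * v $ r" for i
        using bgs_iter_error[OF A diag_nz x v(1) b] eigenvector_pow[OF H ev] v r x by simp
      then have "(\<lambda>i. x $ r + k ^ i * v $ r) \<longlonglongrightarrow> x $ r"
        using conv[of "x + v" r] x v r by simp
      then have "(\<lambda>i. k ^ i * v $ r) \<longlonglongrightarrow> 0"
        using tendsto_diff[OF _ tendsto_const[of "x $ r"]] by fastforce
      then have "(\<lambda>i. norm (k ^ i * v $ r)) \<longlonglongrightarrow> 0"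
        by (rule tendsto_norm_zero)
      moreover have "norm (v $ r) \<le> norm (k ^ i * v $ r)" for i
        using mult_right_mono[OF one_le_power[OF k, of i] norm_ge_zero[of "v $ r"]]
        by (simp add: norm_mult norm_power)
      ultimately have "norm (v $ r) \<le> 0"
        by (intro LIMSEQ_le_const) auto
      then show False using r by simp
    qed
    then show "spectral_radius (bgs_mat A) < 1"
      using spectral_radius_less_1_iff[OF H n] by blast
  }
  {
    assume lt: "spectral_radius (bgs_mat A) < 1"
    \<comment> \<open>A kernel vector of \<open>A\<close> is a fixed point of the step with zero
      right-hand side, so a nonzero one would be an eigenvector for 1.\<close>
    have inj: "v = 0\<^sub>v n" if v: "v \<in> carrier_vec n" "A *\<^sub>v v = 0\<^sub>v n" for v
    proof (rule ccontr)
      assume "v \<noteq> 0\<^sub>v n"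
      have "bgs_mat A *\<^sub>v v + inv_mat (diag_part A - upper_part A) *\<^sub>v 0\<^sub>v n = bgs_mat A *\<^sub>v v"
        using H diag_minus_upper_inverse(1)[OF A diag_nz] v by (intro eq_vecI) auto
      then have "v = bgs_mat A *\<^sub>v v" using bgs_mat_fixpoint_iff[OF A diag_nz v(1), of "0\<^sub>v n"] v(2) by simp
      then have "eigenvector (bgs_mat A) v 1"
        using v H \<open>v \<noteq> 0\<^sub>v n\<close> by (simp add: eigenvector_def)
      then show False using spectral_radius_less_1_iff[OF H n] lt by fastforce
    qed
    then have "det A \<noteq> 0" using det_0_iff_vec_prod_zero_field[OF A] by blast
    note inv = inv_mat_inverse[OF A this]
    define x where "x = inv_mat A *\<^sub>v b"
    have x: "x \<in> carrier_vec n" "A *\<^sub>v x = b"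
      using inv A b by (simp_all add: x_def flip: assoc_mult_mat_vec[OF A inv(1) b])
    have uniq: "y = x" if y: "y \<in> carrier_vec n" "A *\<^sub>v y = b" for y
    proof -
      have "y = inv_mat A *\<^sub>v (A *\<^sub>v y)"
        using assoc_mult_mat_vec[OF inv(1) A y(1)] inv(3) y(1) by simp
      then show ?thesis using y by (simp add: x_def)
    qed
    have "(\<lambda>k. bgs_iter A b x0 k $ r) \<longlonglongrightarrow> x $ r"
      if x0: "x0 \<in> carrier_vec n" and r: "r < n" for x0 r
    proof -
      define w where "w = x0 - x"
      have w: "w \<in> carrier_vec n" and x0_eq: "x0 = x + w"
        using x x0 by (auto simp: w_def)
      have "bgs_iter A b x0 k $ r = x $ r + (\<Sum>j<n. (bgs_mat A ^\<^sub>m k) $$ (r, j) * w $ j)" for k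
      proof -
        have "bgs_iter A b x0 k = x + bgs_mat A ^\<^sub>m k *\<^sub>v w"
          unfolding x0_eq by (rule bgs_iter_error[OF A diag_nz x w b])
        then show ?thesis
          using r x w H by (auto simp: scalar_prod_def atLeast0LessThan pow_mat_dim intro!: sum.cong)
      qed
      moreover have "(\<lambda>k. x $ r + (\<Sum>j<n. (bgs_mat A ^\<^sub>m k) $$ (r, j) * w $ j)) \<longlonglongrightarrow>
          x $ r + (\<Sum>j<n. 0 * w $ j)"
        using r by (intro tendsto_intros spectral_radius_less_1_pow_tendsto_0[OF H lt]) auto
      ultimately show ?thesis by simp
    qed
    note lim = this
    have dim: "dim_col A = n" using A by simp
    show "bgs_converges A b"
      unfolding bgs_converges_def dim
      by (intro bexI[of _ x] conjI ballI allI impI) (fact x | erule (1) uniq | erule (1) lim)+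
  }
qed

section \<open>Eigenvalues outside the open unit disc correspond to ray patterns\<close>

theorem theorem4p10:
  fixes n :: nat and A :: "complex mat"
  assumes "n \<ge> 3"
    and "irreducible_mat A"
    and "A \<in> diag_equipotent n"
  shows "(spectral_radius (bgs_mat A) < 1 \<longleftrightarrow>
            (\<forall>\<phi> :: real. inv_mat (diag_part A) * A \<notin> ray_class n \<phi>)) \<and>
         (\<forall>b \<in> carrier_vec n. spectral_radius (bgs_mat A) < 1 \<longleftrightarrow> bgs_converges A b)"
proof -
  have A: "A \<in> carrier_mat n n" using assms(3) by (simp add: diag_equipotent_def)
  have n: "2 \<le> n" "0 < n" using assms(1) by auto
  have nz: "\<forall>i<n. A $$ (i, i) \<noteq> 0"
    using diag_equipotent_diag_nonzero[OF assms(2,3) n(1)] by blast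
  note H = bgs_mat_carrier[OF A nz]
  define B where "B = inv_mat (diag_part A) * A"
  have diag: "diag_part A \<in> carrier_mat n n" using A by (simp add: diag_part_def)
  have "det (diag_part A) \<noteq> 0"
    by (rule det_upper_triangular_nonzero[OF diag])
      (use A nz in \<open>auto simp: diag_part_def upper_triangular_def\<close>)
  from inv_mat_inverse(1)[OF diag this] have B: "B \<in> carrier_mat n n"
    using A by (simp add: B_def)
  have B_ix: "B $$ (i, j) = A $$ (i, j) / A $$ (i, i)" if "i < n" "j < n" for i j
    unfolding B_def by (rule inv_diag_part_mult_index[OF A nz that])
  have B_diag: "\<forall>i<n. B $$ (i, i) = 1" using B_ix nz by simp
  note ray_iff = ray_class_iff_unimodular[OF B n(2) B_diag]
  have row_sum: "(\<Sum>j \<in> {..<n} - {i}. norm (B $$ (i, j))) = 1" if "i < n" for i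
  proof -
    have "(\<Sum>j \<in> {..<n} - {i}. norm (B $$ (i, j))) =
        (\<Sum>j \<in> {..<n} - {i}. norm (A $$ (i, j))) / norm (A $$ (i, i))"
      using that by (simp add: B_ix norm_divide sum_divide_distrib)
    also have "(\<Sum>j \<in> {..<n} - {i}. norm (A $$ (i, j))) = norm (A $$ (i, i))"
      using assms(3) that by (simp add: diag_equipotent_def)
    finally show ?thesis using nz that by simp
  qed
  have "(\<exists>k v. eigenvector (bgs_mat A) v k \<and> 1 \<le> norm k) \<longleftrightarrow> (\<exists>\<phi>. B \<in> ray_class n \<phi>)"
  proof
    assume "\<exists>k v. eigenvector (bgs_mat A) v k \<and> 1 \<le> norm k"
    then obtain k v where v: "v \<in> carrier_vec n" "v \<noteq> 0\<^sub>v n" "bgs_mat A *\<^sub>v v = k \<cdot>\<^sub>v v"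
      and k1: "1 \<le> norm k"
      using H by (auto simp: eigenvector_def)
    note per = bgs_mat_peripheral_eigenvector[OF A nz assms(2,3) n(1) v k1]
    from per(2) obtain m where m: "m > 0" "\<And>i. i < n \<Longrightarrow> norm (v $ i) = m"
      and al: "\<And>i j. i < n \<Longrightarrow> j < n \<Longrightarrow> i \<noteq> j \<Longrightarrow>
        - (if j < i then 1 else k) * B $$ (i, j) * v $ j = norm (B $$ (i, j)) * (k * v $ i)"
      using B_ix by auto
    \<comment> \<open>Since \<open>norm k = 1\<close>, the eigenvalue is \<open>cis \<phi>\<close>
      for \<open>\<phi> = Arg k\<close>; dividing \<open>v\<close> by its constant modulus
      \<open>m\<close> then gives the unimodular vector.\<close>
    have k: "cis (Arg k) = k" "k \<noteq> 0"
      using per(1) rcis_cmod_Arg[of k] by (auto simp: rcis_def)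
    have "B \<in> ray_class n (Arg k)"
      unfolding ray_iff
    proof (intro exI[of _ "\<lambda>i. v $ i / m"] conjI allI impI)
      show "norm (v $ i / m) = 1" if "i < n" for i
        using m that by (simp add: norm_divide)
      show "B $$ (i, j) * (v $ j / m) =
          - norm (B $$ (i, j)) * (if j < i then cis (Arg k) else 1) * (v $ i / m)"
        if ij: "i < n" "j < n" "i \<noteq> j" for i j
      proof -
        have "B $$ (i, j) * v $ j = - norm (B $$ (i, j)) * (if j < i then k else 1) * v $ i"
        proof (cases "j < i")
          case True
          then show ?thesis
            using arg_cong[OF al[OF ij], of uminus] by (simp add: mult_ac)
        next
          case False
          \<comment> \<open>Above the diagonal both sides of the alignment carry the factor
            \<open>k\<close>, which cancels.\<close>
          then have "k * (B $$ (i, j) * v $ j) = k * (- norm (B $$ (i, j)) * v $ i)"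
            using arg_cong[OF al[OF ij], of uminus] by (simp add: mult_ac)
          then have "B $$ (i, j) * v $ j = - norm (B $$ (i, j)) * v $ i"
            using mult_left_cancel[OF k(2)] by blast
          then show ?thesis using False by simp
        qed
        then show ?thesis using k(1) by (simp add: field_simps)
      qed
    qed
    then show "\<exists>\<phi>. B \<in> ray_class n \<phi>" ..
  next
    assume "\<exists>\<phi>. B \<in> ray_class n \<phi>"
    then obtain \<phi> u where u: "\<And>i. i < n \<Longrightarrow> norm (u i) = 1"
      and Bu: "\<And>i j. i < n \<Longrightarrow> j < n \<Longrightarrow> i \<noteq> j \<Longrightarrow>
        B $$ (i, j) * u j = - norm (B $$ (i, j)) * (if j < i then cis \<phi> else 1) * u i"
      unfolding ray_iff by blast
    \<comment> \<open>The unimodular vector itself is the eigenvector, for the eigenvalue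
      \<open>cis \<phi>\<close>.\<close>
    define v where "v = vec n u"
    have v: "v \<in> carrier_vec n" by (simp add: v_def)
    have "bgs_mat A *\<^sub>v v = cis \<phi> \<cdot>\<^sub>v v"
      unfolding bgs_mat_eigen_iff[OF A nz v]
    proof (intro allI impI)
      fix i assume i: "i < n"
      have "(\<Sum>j \<in> {..<n} - {i}. - (if j < i then 1 else cis \<phi>) * (A $$ (i, j) / A $$ (i, i)) * v $ j)
          = (\<Sum>j \<in> {..<n} - {i}. norm (B $$ (i, j)) * (cis \<phi> * u i))"
      proof (intro sum.cong refl)
        fix j assume j: "j \<in> {..<n} - {i}"
        then have "- (if j < i then 1 else cis \<phi>) * (A $$ (i, j) / A $$ (i, i)) * v $ j =
            - (if j < i then 1 else cis \<phi>) * (B $$ (i, j) * u j)"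
          using i by (simp add: B_ix v_def)
        also have "\<dots> = norm (B $$ (i, j)) * (cis \<phi> * u i)"
          using Bu[of i j] i j by simp
        finally show "- (if j < i then 1 else cis \<phi>) * (A $$ (i, j) / A $$ (i, i)) * v $ j =
            norm (B $$ (i, j)) * (cis \<phi> * u i)" .
      qed
      \<comment> \<open>The aligned terms have total weight 1 by the equipotence of row
        \<open>i\<close>.\<close>
      also have "\<dots> = cis \<phi> * v $ i"
        using i row_sum[OF i]
        by (simp add: v_def flip: sum_distrib_right of_real_sum)
      finally show "cis \<phi> * v $ i =
        (\<Sum>j \<in> {..<n} - {i}. - (if j < i then 1 else cis \<phi>) * (A $$ (i, j) / A $$ (i, i)) * v $ j)"
        by simp
    qed
    moreover have "v \<noteq> 0\<^sub>v n"
      using u[OF n(2)] n(2) by (auto simp: v_def vec_eq_iff)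
    ultimately have "eigenvector (bgs_mat A) v (cis \<phi>)"
      using v H by (simp add: eigenvector_def)
    then show "\<exists>k v. eigenvector (bgs_mat A) v k \<and> 1 \<le> norm k" by (metis norm_cis order_refl)
  qed
  then have "spectral_radius (bgs_mat A) < 1 \<longleftrightarrow> (\<forall>\<phi>. B \<notin> ray_class n \<phi>)"
    using spectral_radius_less_1_iff[OF H n(2)] by blast
  then show ?thesis
    using bgs_converges_iff[OF A nz n(2)] by (simp add: B_def)
qed

end
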